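(* Let $G$ be a cactus graph on $n\geq 4$ vertices with at least two cycles. Then $n-4\leq \operatorname{Z}(\overline{G})\leq n-2$. Furthermore: (1) $\operatorname{Z}(\overline{G})=n-2$ if and only if $G$ is obtained from the star $K_{1,n-1}$ by adding at least two pairwise vertex-disjoint edges between leaves; (2) $\operatorname{Z}(\overline{G})=n-4$ if and only if $G$ contains a $4$-cycle $C$ having two adjacent vertices each of which has a neighbor not on $C$; (3) $\operatorname{Z}(\overline{G})=n-3$ otherwise.
   Context: All graphs are finite, simple and undirected. A cactus graph is a connected graph in which any two simple cycles have at most one vertex in common. $K_{1,n-1}$ is the star on $n$ vertices. $\overline{G}$ denotes the complement of $G$ (same vertex set; distinct vertices adjacent iff not adjacent in $G$). Zero forcing: given an initial set $B\subseteq V(G)$ of blue vertices (all others white), a blue vertex with exactly one white neighbor may turn that neighbor blue; $B$ is a zero forcing set if repeated application makes all vertices blue. $\operatorname{Z}(G)$ is the minimum size of a zero forcing set of $G$. *)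

theory Defs
  imports "Graph_Theory.Pair_Digraph" "Graph_Theory.Digraph_Component"
begin

text \<open>
  A finite simple undirected graph is a \<^locale>\<open>pair_graph\<close>: an edge between \<open>u\<close> and \<open>v\<close>
  is represented by the two arcs \<open>(u, v)\<close> and \<open>(v, u)\<close>.
\<close>

definition complement_graph :: "'a pair_pre_digraph \<Rightarrow> 'a pair_pre_digraph" where
  "complement_graph G = \<lparr> pverts = pverts G,
     parcs = {(u, v). u \<in> pverts G \<and> v \<in> pverts G \<and> u \<noteq> v \<and> (u, v) \<notin> parcs G} \<rparr>"

text \<open>
  The walk \<open>u, v, u\<close> is a cycle of a symmetric digraph in the sense of
  \<^const>\<open>pre_digraph.cycle\<close>, but not of the undirected graph; hence the length bound.
  Cycles are subgraphs, so that all closed walks differing only in starting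
  point and direction give the same cycle.
\<close>

definition cycle_subgraph :: "('a \<times> 'a) list \<Rightarrow> 'a pair_pre_digraph" where
  "cycle_subgraph p = \<lparr> pverts = fst ` set p, parcs = set p \<union> (set p)\<inverse> \<rparr>"

definition cycles :: "'a pair_pre_digraph \<Rightarrow> 'a pair_pre_digraph set" where
  "cycles G = {cycle_subgraph p | p. pre_digraph.cycle (with_proj G) p \<and> length p \<ge> 3}"

definition cactus :: "'a pair_pre_digraph \<Rightarrow> bool" where
  "cactus G \<longleftrightarrow> pair_graph G \<and> connected (with_proj G) \<and>
     (\<forall>C \<in> cycles G. \<forall>D \<in> cycles G. C \<noteq> D \<longrightarrow> card (pverts C \<inter> pverts D) \<le> 1)"

definition force_step :: "'a pair_pre_digraph \<Rightarrow> 'a set \<Rightarrow> 'a set \<Rightarrow> bool" where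
  "force_step G B B' \<longleftrightarrow>
     (\<exists>u \<in> B. \<exists>v. {w. (u, w) \<in> parcs G \<and> w \<notin> B} = {v} \<and> B' = insert v B)"

definition zero_forcing_set :: "'a pair_pre_digraph \<Rightarrow> 'a set \<Rightarrow> bool" where
  "zero_forcing_set G B \<longleftrightarrow> B \<subseteq> pverts G \<and> (force_step G)\<^sup>*\<^sup>* B (pverts G)"

definition zero_forcing_number :: "'a pair_pre_digraph \<Rightarrow> nat" where
  "zero_forcing_number G = (LEAST k. \<exists>B. zero_forcing_set G B \<and> card B = k)"

definition star_graph :: "'a \<Rightarrow> 'a set \<Rightarrow> 'a pair_pre_digraph" where
  "star_graph c L = \<lparr> pverts = insert c L, parcs = {c} \<times> L \<union> L \<times> {c} \<rparr>"

definition add_edges :: "'a pair_pre_digraph \<Rightarrow> 'a set set \<Rightarrow> 'a pair_pre_digraph" where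
  "add_edges G M = \<lparr> pverts = pverts G, parcs = parcs G \<union> {(u, v). {u, v} \<in> M} \<rparr>"

definition star_plus_disjoint_edges :: "'a pair_pre_digraph \<Rightarrow> bool" where
  "star_plus_disjoint_edges G \<longleftrightarrow>
     (\<exists>c L M. c \<notin> L \<and> (\<forall>e \<in> M. e \<subseteq> L \<and> card e = 2) \<and> pairwise disjnt M \<and> card M \<ge> 2 \<and>
        G = add_edges (star_graph c L) M)"

definition has_special_4_cycle :: "'a pair_pre_digraph \<Rightarrow> bool" where
  "has_special_4_cycle G \<longleftrightarrow>
     (\<exists>C \<in> cycles G. card (pverts C) = 4 \<and>
        (\<exists>u v. (u, v) \<in> parcs C \<and>
           (\<exists>x. (u, x) \<in> parcs G \<and> x \<notin> pverts C) \<and>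
           (\<exists>y. (v, y) \<in> parcs G \<and> y \<notin> pverts C)))"

end

theory Submission
  imports Defs
begin

text \<open>
  Record a zero forcing process on the complement as the sequence of its forces \<open>(u\<^sub>i, w\<^sub>i)\<close>.
  In terms of \<open>G\<close> this says that \<open>u\<^sub>i\<close> and \<open>w\<^sub>i\<close> are distinct and non-adjacent, while \<open>u\<^sub>i\<close> is
  adjacent to every later \<open>w\<^sub>j\<close>. Hence the zero forcing number of the complement is \<open>n - k\<close> for the
  largest length \<open>k\<close> of such a sequence.

  Length five puts a \<open>K\<^sub>2\<^sub>,\<^sub>3\<close> into \<open>G\<close>, which a cactus does not contain. In length four,
  \<open>u\<^sub>1 w\<^sub>3 u\<^sub>2 w\<^sub>4\<close> is a 4-cycle whose adjacent vertices \<open>u\<^sub>1\<close> and \<open>w\<^sub>4\<close> have the outside neighbours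
  \<open>w\<^sub>2\<close> and \<open>u\<^sub>3\<close>. Length three amounts to a path \<open>w\<^sub>2 u\<^sub>1 w\<^sub>3 u\<^sub>2\<close> with non-adjacent ends and inner
  vertices that are not universal; in a cactus with two cycles it exists exactly if no vertex is
  universal, and a cactus with a universal vertex is a star plus a matching on its leaves.
\<close>

section \<open>Forcing sequences\<close>

text \<open>The initial blue set is left implicit: it consists of the vertices that are not second
  components. Blueness of \<open>u\<close> at its turn needs no clause, since \<open>u\<close>
  differs from its own target and, without loops, from the later targets, to which it is
  adjacent.\<close>

fun forcing_seq :: "'a pair_pre_digraph \<Rightarrow> ('a \<times> 'a) list \<Rightarrow> bool" where
  "forcing_seq G [] \<longleftrightarrow> True"
| "forcing_seq G ((u, w) # ps) \<longleftrightarrow> u \<in> pverts G \<and> w \<in> pverts G \<and> u \<noteq> w \<and> (u, w) \<notin> parcs G \<and>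
     (\<forall>p \<in> set ps. (u, snd p) \<in> parcs G) \<and> forcing_seq G ps"

lemma forcing_seq_snd_subset: "forcing_seq G ps \<Longrightarrow> snd ` set ps \<subseteq> pverts G"
proof (induction ps)
  case (Cons p ps)
  then show ?case by (cases p) simp
qed simp

text \<open>Targets do not repeat, because \<open>u\<close> is adjacent to every later target but
  not to its own.\<close>

lemma card_snd_forcing_seq: "forcing_seq G ps \<Longrightarrow> card (snd ` set ps) = length ps"
proof (induction ps)
  case (Cons p ps)
  obtain u w where p: "p = (u, w)" by (cases p)
  have "w \<notin> snd ` set ps" using Cons.prems p by auto
  then show ?case using Cons p by simp
qed simp

lemma forcing_seq_shorten:
  assumes "forcing_seq G ps" "k \<le> length ps"
  shows "\<exists>qs. forcing_seq G qs \<and> length qs = k"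
  using assms
proof (induction ps)
  case (Cons p ps)
  show ?case
  proof (cases "k = length (p # ps)")
    case False
    then show ?thesis using Cons by (cases p) auto
  qed (use Cons.prems in blast)
qed auto

lemma forcing_seq_if_forces:
  assumes "(force_step (complement_graph G))\<^sup>*\<^sup>* B (pverts G)" "B \<subseteq> pverts G"
  shows "\<exists>ps. forcing_seq G ps \<and> snd ` set ps = pverts G - B"
  using assms
proof (induction rule: converse_rtranclp_induct)
  case base
  show ?case by (rule exI[of _ "[]"]) simp
next
  case (step B B')
  from step.hyps(1) obtain u v where u: "u \<in> B"
    and v: "{w. (u, w) \<in> parcs (complement_graph G) \<and> w \<notin> B} = {v}" and B': "B' = insert v B"
    unfolding force_step_def by blast
  have vB: "v \<in> pverts G" "v \<notin> B" "u \<noteq> v" "(u, v) \<notin> parcs G"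
    using v unfolding complement_graph_def by auto
  then obtain ps where ps: "forcing_seq G ps" "snd ` set ps = pverts G - B'"
    using step B' by auto
  \<comment> \<open>In the complement \<open>v\<close> is the only white neighbor of
    \<open>u\<close>, so \<open>u\<close> is adjacent in \<open>G\<close> to all vertices that stay
    white.\<close>
  have "(u, w) \<in> parcs G" if "w \<in> pverts G - B'" for w
  proof -
    have "(u, w) \<notin> parcs (complement_graph G)" using v that B' by blast
    moreover have "u \<noteq> w" "u \<in> pverts G" using that B' u step.prems by auto
    ultimately show ?thesis using that unfolding complement_graph_def by auto
  qed
  then have "forcing_seq G ((u, v) # ps)" using ps vB u step.prems by auto
  moreover have "snd ` set ((u, v) # ps) = pverts G - B" using ps(2) vB B' by auto
  ultimately show ?case by blast
qed

lemma (in pair_graph) forces_if_forcing_seq: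
  assumes "forcing_seq G ps"
  shows "(force_step (complement_graph G))\<^sup>*\<^sup>* (pverts G - snd ` set ps) (pverts G)"
  using assms
proof (induction ps)
  case (Cons p ps)
  obtain u w where p: "p = (u, w)" by (cases p)
  let ?W = "snd ` set ps"
  have h: "u \<in> pverts G" "w \<in> pverts G" "u \<noteq> w" "(u, w) \<notin> parcs G" "\<forall>x \<in> ?W. (u, x) \<in> parcs G"
      "forcing_seq G ps"
    using Cons.prems p by auto
  have "u \<notin> ?W" using h(5) pair_no_loops by force
  then have "u \<in> pverts G - snd ` set (p # ps)" using p h by auto
  moreover have "{x. (u, x) \<in> parcs (complement_graph G) \<and> x \<notin> pverts G - snd ` set (p # ps)} = {w}"
    using h p unfolding complement_graph_def by auto
  moreover have "w \<notin> ?W" using h by auto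
  then have "pverts G - ?W = insert w (pverts G - snd ` set (p # ps))" using p h by auto
  ultimately have "force_step (complement_graph G) (pverts G - snd ` set (p # ps)) (pverts G - ?W)"
    unfolding force_step_def by blast
  then show ?case using Cons.IH h by (meson converse_rtranclp_into_rtranclp)
qed simp

lemma (in pair_graph) zero_forcing_number_le:
  assumes "forcing_seq G ps"
  shows "zero_forcing_number (complement_graph G) \<le> card (pverts G) - length ps"
proof -
  let ?B = "pverts G - snd ` set ps"
  have "zero_forcing_set (complement_graph G) ?B"
    using forces_if_forcing_seq[OF assms]
    by (auto simp: zero_forcing_set_def complement_graph_def)
  moreover have "card ?B = card (pverts G) - length ps"
    using card_Diff_subset[of "snd ` set ps" "pverts G"] forcing_seq_snd_subset[OF assms]
      card_snd_forcing_seq[OF assms] by simp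
  ultimately show ?thesis unfolding zero_forcing_number_def by (intro Least_le) blast
qed

lemma (in pair_graph) zero_forcing_number_attained:
  "\<exists>ps. forcing_seq G ps \<and> zero_forcing_number (complement_graph G) + length ps = card (pverts G)"
proof -
  let ?H = "complement_graph G"
  \<comment> \<open>The full vertex set forces trivially, so the \<open>LEAST\<close> in
    \<open>zero_forcing_number\<close> is attained.\<close>
  have "zero_forcing_set ?H (pverts G)" by (auto simp: zero_forcing_set_def complement_graph_def)
  then have "\<exists>k B. zero_forcing_set ?H B \<and> card B = k" by blast
  from LeastI_ex[OF this] obtain B where B: "zero_forcing_set ?H B" "card B = zero_forcing_number ?H"
    unfolding zero_forcing_number_def by blast
  then have sub: "B \<subseteq> pverts G" and "(force_step ?H)\<^sup>*\<^sup>* B (pverts G)"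
    by (auto simp: zero_forcing_set_def complement_graph_def)
  from forcing_seq_if_forces[OF this(2,1)] obtain ps
    where ps: "forcing_seq G ps" "snd ` set ps = pverts G - B" by blast
  have "card B \<le> card (pverts G)" using sub pair_finite_verts by (rule card_mono[rotated])
  then have "card B + length ps = card (pverts G)"
    using card_snd_forcing_seq[OF ps(1)] ps(2) card_Diff_subset[of B "pverts G"] sub
      finite_subset[OF sub pair_finite_verts] by simp
  then show ?thesis using ps(1) B(2) by auto
qed

section \<open>Short cycles in a cactus\<close>

locale cactus_graph = pair_graph +
  assumes cactus: "cactus G"
begin

abbreviation adj :: "'a \<Rightarrow> 'a \<Rightarrow> bool" (infix \<open>\<frown>\<close> 50) where
  "a \<frown> b \<equiv> (a, b) \<in> parcs G"

lemma adj_sym: "a \<frown> b \<Longrightarrow> b \<frown> a"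
  using pair_sym_arcs unfolding symmetric_def by (simp add: sym_def)

lemma adj_irrefl: "\<not> a \<frown> a"
  using pair_no_loops by force

lemma triangle_in_cycles:
  assumes "a \<frown> b" "b \<frown> c" "c \<frown> a"
  shows "cycle_subgraph [(a, b), (b, c), (c, a)] \<in> cycles G"
proof -
  have "pre_digraph.cycle (with_proj G) [(a, b), (b, c), (c, a)]"
    unfolding pre_digraph.cycle_def pre_digraph.awalk_def
    using assms adj_irrefl by (intro exI[of _ a]) (auto simp: wellformed')
  then show ?thesis unfolding cycles_def by force
qed

lemma four_cycle_in_cycles:
  assumes "a \<frown> b" "b \<frown> c" "c \<frown> d" "d \<frown> a" "a \<noteq> c" "b \<noteq> d"
  shows "cycle_subgraph [(a, b), (b, c), (c, d), (d, a)] \<in> cycles G"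
proof -
  have "pre_digraph.cycle (with_proj G) [(a, b), (b, c), (c, d), (d, a)]"
    unfolding pre_digraph.cycle_def pre_digraph.awalk_def
    using assms adj_irrefl by (intro exI[of _ a]) (auto simp: wellformed')
  then show ?thesis unfolding cycles_def by force
qed

lemma finite_pverts_cycle: "C \<in> cycles G \<Longrightarrow> finite (pverts C)"
  unfolding cycles_def cycle_subgraph_def by auto

text \<open>The form in which the cactus condition is used below: two cycles built by hand share two
  vertices, hence coincide, and comparing their vertex sets gives the claim.\<close>

lemma cycle_verts_eq:
  assumes "C \<in> cycles G" "D \<in> cycles G" "a \<noteq> b" "{a, b} \<subseteq> pverts C" "{a, b} \<subseteq> pverts D"
  shows "C = D"
proof (rule ccontr)
  assume "C \<noteq> D"
  then have "card (pverts C \<inter> pverts D) \<le> 1" using cactus assms unfolding cactus_def by blast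
  moreover have "card {a, b} \<le> card (pverts C \<inter> pverts D)"
    using assms finite_pverts_cycle by (intro card_mono) auto
  ultimately show False using assms(3) by simp
qed

lemma triangles_sharing_edge:
  assumes "a \<frown> b" "a \<frown> x" "x \<frown> b" "a \<frown> y" "y \<frown> b"
  shows "x = y"
proof -
  have "cycle_subgraph [(a, b), (b, x), (x, a)] = cycle_subgraph [(a, b), (b, y), (y, a)]"
    using assms adj_sym adj_irrefl
    by (intro cycle_verts_eq[of _ _ a b] triangle_in_cycles) (auto simp: cycle_subgraph_def)
  then have "{a, b, x} = {a, b, y}" by (simp add: cycle_subgraph_def)
  then have "x \<in> {a, b, y}" by blast
  then show ?thesis using assms adj_irrefl by auto
qed

lemma four_cycle_no_triangle:
  assumes "a \<frown> b" "b \<frown> c" "c \<frown> d" "d \<frown> a" "a \<noteq> c" "b \<noteq> d"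
  shows "\<not> (a \<frown> x \<and> x \<frown> b)"
proof
  assume x: "a \<frown> x \<and> x \<frown> b"
  have "cycle_subgraph [(a, b), (b, c), (c, d), (d, a)] = cycle_subgraph [(a, b), (b, x), (x, a)]"
    using assms x adj_sym adj_irrefl
    by (intro cycle_verts_eq[of _ _ a b] triangle_in_cycles four_cycle_in_cycles)
      (auto simp: cycle_subgraph_def)
  then have "{a, b, c, d} = {a, b, x}" by (simp add: cycle_subgraph_def)
  then have "c \<in> {a, b, x}" "d \<in> {a, b, x}" by blast+
  then show False using assms adj_irrefl by auto
qed

text \<open>A third common neighbor \<open>x\<close> would give a second 4-cycle through
  \<open>a\<close>, \<open>b\<close>, \<open>c\<close>. This excludes
  \<open>K_{2,3}\<close>.\<close>

lemma common_neighbours_le_2: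
  assumes "a \<noteq> c" "b \<noteq> d" "a \<frown> b" "c \<frown> b" "a \<frown> d" "c \<frown> d" "a \<frown> x" "c \<frown> x"
  shows "x = b \<or> x = d"
proof (rule ccontr)
  assume x: "\<not> (x = b \<or> x = d)"
  have "cycle_subgraph [(a, b), (b, c), (c, d), (d, a)] = cycle_subgraph [(a, b), (b, c), (c, x), (x, a)]"
    using assms x adj_sym adj_irrefl
    by (intro cycle_verts_eq[of _ _ a c] four_cycle_in_cycles) (auto simp: cycle_subgraph_def)
  then have "{a, b, c, d} = {a, b, c, x}" by (simp add: cycle_subgraph_def)
  then have "d \<in> {a, b, c, x}" by blast
  then show False using assms x adj_irrefl by auto
qed

lemma four_cycle_no_chord:
  assumes "a \<frown> b" "b \<frown> c" "c \<frown> d" "d \<frown> a" "a \<noteq> c" "b \<noteq> d"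
  shows "\<not> a \<frown> c"
  \<comment> \<open>A chord \<open>a c\<close> makes \<open>a b c\<close> a triangle on the edge
    \<open>a b\<close> of the 4-cycle.\<close>
  using four_cycle_no_triangle[OF assms, of c] assms(2) adj_sym by blast

section \<open>Shapes of arbitrary cycles, and connectedness\<close>

lemma pcas_last_in_verts: "pcas u p v \<Longrightarrow> v \<in> set (pawalk_verts u p)"
  by (induction p arbitrary: u) auto

text \<open>A cycle is unrolled into three arcs and a walk \<open>q\<close> from \<open>d\<close>
  back to \<open>a\<close>. The start \<open>a\<close> is not listed first in the distinctness
  claim, as it reappears as the end of \<open>q\<close>.\<close>

lemma cycleE:
  assumes "C \<in> cycles G"
  obtains a b c d q where "C = cycle_subgraph ((a, b) # (b, c) # (c, d) # q)"
    "set q \<subseteq> parcs G" "a \<frown> b" "b \<frown> c" "c \<frown> d" "pcas d q a"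
    "distinct (b # c # pawalk_verts d q)"
proof -
  obtain p u where C: "C = cycle_subgraph p" and len: "length p \<ge> 3" and arcs: "set p \<subseteq> parcs G"
    and cas: "pcas u p u" and dist: "distinct (tl (pawalk_verts u p))"
    using assms unfolding cycles_def pre_digraph.cycle_def pre_digraph.awalk_def by auto
  obtain e1 e2 e3 q where p: "p = e1 # e2 # e3 # q"
    using len by (auto simp: numeral_3_eq_3 Suc_le_length_iff)
  obtain a b where e1: "e1 = (a, b)" by (cases e1)
  obtain c where e2: "e2 = (b, c)" using cas p e1 by (cases e2) auto
  obtain d where e3: "e3 = (c, d)" using cas p e1 e2 by (cases e3) auto
  have "u = a" using cas p e1 by simp
  then show thesis using that[of a b c d q] C arcs cas dist unfolding p e1 e2 e3 by auto
qed

text \<open>If \<open>q\<close> is empty, then \<open>d = a\<close>; otherwise \<open>a\<close>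
  occurs after \<open>d\<close> on the remaining walk and so differs from \<open>b\<close>,
  \<open>c\<close>, \<open>d\<close>.\<close>

lemma cycle_shape:
  assumes "C \<in> cycles G"
  obtains (triangle) a b c where "distinct [a, b, c]" "pverts C = {a, b, c}" "a \<frown> b" "b \<frown> c" "c \<frown> a"
  | (path) a b c d where "distinct [a, b, c, d]" "{a, b, c, d} \<subseteq> pverts C" "a \<frown> b" "b \<frown> c" "c \<frown> d"
proof -
  obtain a b c d q where C: "C = cycle_subgraph ((a, b) # (b, c) # (c, d) # q)"
    and h: "set q \<subseteq> parcs G" "a \<frown> b" "b \<frown> c" "c \<frown> d" "pcas d q a"
      "distinct (b # c # pawalk_verts d q)"
    using assms by (rule cycleE)
  show thesis
  proof (cases q)
    case Nil
    then show thesis using triangle[of a b c] C h by (auto simp: cycle_subgraph_def)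
  next
    case (Cons e r)
    then have "a \<in> set (pawalk_verts (snd e) r)" using h(5) pcas_last_in_verts by auto
    then show thesis using path[of a b c d] C h Cons by (auto simp: cycle_subgraph_def)
  qed
qed

lemma four_cycleE:
  assumes "C \<in> cycles G" "card (pverts C) = 4"
  obtains a b c d where "C = cycle_subgraph [(a, b), (b, c), (c, d), (d, a)]"
    "a \<frown> b" "b \<frown> c" "c \<frown> d" "d \<frown> a" "a \<noteq> c" "b \<noteq> d"
proof -
  obtain a b c d q where C: "C = cycle_subgraph ((a, b) # (b, c) # (c, d) # q)"
    and h: "set q \<subseteq> parcs G" "a \<frown> b" "b \<frown> c" "c \<frown> d" "pcas d q a"
      "distinct (b # c # pawalk_verts d q)"
    using assms(1) by (rule cycleE)
  \<comment> \<open>Only a single closing arc fits four vertices: an empty \<open>q\<close> leaves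
    three, and two or more arcs give at least five.\<close>
  consider "q = []" | e where "q = [e]" | e f r where "q = e # f # r"
    by (metis neq_Nil_conv)
  then show thesis
  proof cases
    case 1
    then show thesis using C h assms(2) by (auto simp: cycle_subgraph_def card_insert_if split: if_splits)
  next
    case 2
    then show thesis using that[of a b c d] C h by (cases e) auto
  next
    case 3
    then have "a \<in> set (pawalk_verts (snd f) r)" using h(5) pcas_last_in_verts by auto
    then have "distinct [a, b, c, d, fst f]" using h 3 by auto
    then have "card {a, b, c, d, fst f} = 5" by simp
    moreover have "{a, b, c, d, fst f} \<subseteq> pverts C" using C h 3 by (auto simp: cycle_subgraph_def)
    ultimately show thesis
      using card_mono[OF finite_pverts_cycle[OF assms(1)], of "{a, b, c, d, fst f}"] assms(2) by simp
  qed
qed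

lemma card_pverts_cycle:
  assumes "C \<in> cycles G"
  shows "card (pverts C) \<ge> 3"
  using assms
proof (cases rule: cycle_shape)
  case (path a b c d)
  then have "card {a, b, c, d} = 4" by simp
  then show ?thesis using card_mono[OF finite_pverts_cycle[OF assms] path(2)] by simp
qed auto

lemma pverts_cycle_subset: "C \<in> cycles G \<Longrightarrow> pverts C \<subseteq> pverts G"
  unfolding cycles_def cycle_subgraph_def pre_digraph.cycle_def pre_digraph.awalk_def
  using arc_fst_in_verts by force

text \<open>A triangle has an edge opposite \<open>z\<close>, and a longer cycle has two disjoint
  edges. With \<open>z\<close> a universal vertex this yields an edge between leaves.\<close>

lemma cycle_edge_avoiding:
  assumes "C \<in> cycles G"
  obtains x y where "x \<frown> y" "x \<noteq> z" "y \<noteq> z" "{x, y} \<subseteq> pverts C"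
  using assms
proof (cases rule: cycle_shape)
  case (triangle a b c)
  then show thesis using that[of a b] that[of b c] that[of c a] by auto
next
  case (path a b c d)
  then show thesis using that[of a b] that[of c d] by auto
qed

lemma card_pverts_ge_5:
  assumes "C \<in> cycles G" "D \<in> cycles G" "C \<noteq> D"
  shows "card (pverts G) \<ge> 5"
proof -
  have "card (pverts C \<inter> pverts D) \<le> 1" using cactus assms unfolding cactus_def by blast
  moreover have "card (pverts C \<union> pverts D) \<le> card (pverts G)"
    using assms pverts_cycle_subset pair_finite_verts by (intro card_mono) auto
  ultimately show ?thesis
    using card_Un_Int[of "pverts C" "pverts D"] assms finite_pverts_cycle card_pverts_cycle[of C]
      card_pverts_cycle[of D] by simp
qed

text \<open>By connectedness a walk leads from \<open>S\<close> to a vertex outside, and some arc of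
  it must cross.\<close>

lemma edge_leaving:
  assumes "S \<subset> pverts G" "S \<noteq> {}"
  obtains x y where "x \<in> S" "y \<in> pverts G" "y \<notin> S" "x \<frown> y"
proof -
  obtain s t where st: "s \<in> S" "t \<in> pverts G" "t \<notin> S" using assms by blast
  have "reachable (mk_symmetric G) s t"
    using cactus st assms unfolding cactus_def connected_def strongly_connected_def by auto
  then have "(s, t) \<in> (parcs G)\<^sup>*"
    using reachable_mk_symmetric_eq[OF pair_sym_arcs] reachable_rtranclI by force
  then have "\<exists>x y. x \<in> S \<and> y \<notin> S \<and> x \<frown> y"
    using st by (induction rule: converse_rtrancl_induct) blast+
  then show thesis using that wellformed' by blast
qed

section \<open>Forcing sequences of length four\<close>

lemma forcing_seq_length_le_4:
  assumes "forcing_seq G ps"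
  shows "length ps \<le> 4"
proof (rule ccontr)
  assume "\<not> length ps \<le> 4"
  then obtain qs where "forcing_seq G qs" "length qs = 5"
    using forcing_seq_shorten[OF assms, of 5] by auto
  then obtain u1 w1 u2 w2 u3 w3 u4 w4 u5 w5
    where "forcing_seq G [(u1, w1), (u2, w2), (u3, w3), (u4, w4), (u5, w5)]"
    by (auto simp: length_Suc_conv eval_nat_numeral)
  \<comment> \<open>\<open>w4\<close> and \<open>w5\<close> have the common neighbors
    \<open>u1\<close>, \<open>u2\<close>, \<open>u3\<close>. These are distinct, since an earlier
    one is adjacent to the target of a later one, which the later one is not.\<close>
  then show False
    using common_neighbours_le_2[of w4 w5 u1 u2 u3] adj_sym by auto
qed

lemma special_4_cycleI:
  assumes "a \<frown> b" "b \<frown> c" "c \<frown> d" "d \<frown> a" "a \<noteq> c" "b \<noteq> d"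
    and "a \<frown> x" "x \<notin> {a, b, c, d}" "b \<frown> y" "y \<notin> {a, b, c, d}"
  shows "has_special_4_cycle G"
proof -
  let ?C = "cycle_subgraph [(a, b), (b, c), (c, d), (d, a)]"
  have "pverts ?C = {a, b, c, d}" "(a, b) \<in> parcs ?C" by (auto simp: cycle_subgraph_def)
  moreover have "a \<noteq> b" "b \<noteq> c" "c \<noteq> d" "d \<noteq> a" using assms adj_irrefl by auto
  then have "card {a, b, c, d} = 4" using assms(5,6) by auto
  ultimately show ?thesis
    unfolding has_special_4_cycle_def using four_cycle_in_cycles[OF assms(1-6)] assms(7-)
    by (intro bexI[of _ ?C]) metis+
qed

lemma special_4_cycleE:
  assumes "has_special_4_cycle G"
  obtains (elim) a b c d x y where "a \<frown> b" "b \<frown> c" "c \<frown> d" "d \<frown> a" "a \<noteq> c" "b \<noteq> d"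
    "a \<frown> x" "x \<notin> {a, b, c, d}" "b \<frown> y" "y \<notin> {a, b, c, d}"
proof -
  obtain C a' b' x y where C: "C \<in> cycles G" "card (pverts C) = 4" "(a', b') \<in> parcs C"
    and xy: "a' \<frown> x" "x \<notin> pverts C" "b' \<frown> y" "y \<notin> pverts C"
    using assms unfolding has_special_4_cycle_def by blast
  obtain a b c d where abcd: "C = cycle_subgraph [(a, b), (b, c), (c, d), (d, a)]"
    "a \<frown> b" "b \<frown> c" "c \<frown> d" "d \<frown> a" "a \<noteq> c" "b \<noteq> d"
    using C(1,2) by (rule four_cycleE)
  have V: "pverts C = {a, b, c, d}" using abcd(1) by (simp add: cycle_subgraph_def)
  \<comment> \<open>The given arc may be any of the four edges in either direction; the cycle is
    relabelled to start along it.\<close>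
  have rotate: thesis if "a' = p" "b' = q" "p \<frown> q" "q \<frown> r" "r \<frown> s" "s \<frown> p" "p \<noteq> r" "q \<noteq> s"
      "{p, q, r, s} = {a, b, c, d}" for p q r s
    using elim[of p q r s x y] that xy V by simp
  have reversed: "b \<frown> a" "c \<frown> b" "d \<frown> c" "a \<frown> d" using abcd adj_sym by auto
  have "(a', b') \<in> {(a, b), (b, c), (c, d), (d, a), (b, a), (c, b), (d, c), (a, d)}"
    using C(3) abcd(1) by (auto simp: cycle_subgraph_def)
  then consider "a' = a" "b' = b" | "a' = b" "b' = c" | "a' = c" "b' = d" | "a' = d" "b' = a"
    | "a' = b" "b' = a" | "a' = c" "b' = b" | "a' = d" "b' = c" | "a' = a" "b' = d" by auto
  then show thesis
  proof cases
    case 1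
    then show thesis using rotate[of a b c d] abcd(2-) reversed by auto
  next
    case 2
    then show thesis using rotate[of b c d a] abcd(2-) reversed by auto
  next
    case 3
    then show thesis using rotate[of c d a b] abcd(2-) reversed by auto
  next
    case 4
    then show thesis using rotate[of d a b c] abcd(2-) reversed by auto
  next
    case 5
    then show thesis using rotate[of b a d c] abcd(2-) reversed by auto
  next
    case 6
    then show thesis using rotate[of c b a d] abcd(2-) reversed by auto
  next
    case 7
    then show thesis using rotate[of d c b a] abcd(2-) reversed by auto
  next
    case 8
    then show thesis using rotate[of a d c b] abcd(2-) reversed by auto
  qed
qed

lemma forcing_seq_4_iff:
  "(\<exists>ps. forcing_seq G ps \<and> length ps = 4) \<longleftrightarrow> has_special_4_cycle G"
proof
  assume "\<exists>ps. forcing_seq G ps \<and> length ps = 4"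
  then obtain u1 w1 u2 w2 u3 w3 u4 w4
    where "forcing_seq G [(u1, w1), (u2, w2), (u3, w3), (u4, w4)]"
    by (auto simp: length_Suc_conv eval_nat_numeral)
  then have "u1 \<frown> w4" "w4 \<frown> u2" "u2 \<frown> w3" "w3 \<frown> u1" "u1 \<noteq> u2" "w4 \<noteq> w3"
    "u1 \<frown> w2" "w2 \<notin> {u1, w4, u2, w3}" "w4 \<frown> u3" "u3 \<notin> {u1, w4, u2, w3}"
    by (auto dest: adj_sym simp: adj_irrefl)
  then show "has_special_4_cycle G" by (rule special_4_cycleI)
next
  assume "has_special_4_cycle G"
  then obtain a b c d x y where h: "a \<frown> b" "b \<frown> c" "c \<frown> d" "d \<frown> a" "a \<noteq> c" "b \<noteq> d"
    "a \<frown> x" "x \<notin> {a, b, c, d}" "b \<frown> y" "y \<notin> {a, b, c, d}"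
    by (rule special_4_cycleE)
  \<comment> \<open>Otherwise \<open>x\<close> would be a third common neighbor of \<open>a\<close>
    and \<open>c\<close>; likewise \<open>y\<close> for \<open>b\<close> and
    \<open>d\<close>.\<close>
  have "\<not> c \<frown> x" using common_neighbours_le_2[of a c b d x] h adj_sym by blast
  moreover have "\<not> y \<frown> d" using common_neighbours_le_2[of b d a c y] h adj_sym by blast
  moreover have "\<not> a \<frown> c" using four_cycle_no_chord h by blast
  moreover have "\<not> d \<frown> b" using four_cycle_no_chord[of b c d a] h adj_sym by blast
  moreover have "a \<frown> d" "c \<frown> b" "y \<frown> b" using h adj_sym by auto
  \<comment> \<open>The first target and the last forcing vertex lie off the pattern
    \<open>u1 w3 u2 w4\<close>, \<open>w2\<close>, \<open>u3\<close>; the opposite cycle vertices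
    \<open>c\<close> and \<open>d\<close> serve for them.\<close>
  ultimately have "forcing_seq G [(a, c), (c, x), (y, d), (d, b)]"
    using h in_arcsD1 in_arcsD2 by auto
  then show "\<exists>ps. forcing_seq G ps \<and> length ps = 4"
    by (intro exI[of _ "[(a, c), (c, x), (y, d), (d, b)]"]) simp
qed

section \<open>Forcing sequences of length two and three\<close>

text \<open>The path need not be induced: \<open>p r\<close> and \<open>q s\<close> may be edges.
  That \<open>q\<close> and \<open>s\<close> differ follows from \<open>p\<close> being adjacent to
  \<open>q\<close> only.\<close>

definition open_path :: "'a \<Rightarrow> 'a \<Rightarrow> 'a \<Rightarrow> 'a \<Rightarrow> bool" where
  "open_path p q r s \<longleftrightarrow> p \<frown> q \<and> q \<frown> r \<and> r \<frown> s \<and> p \<noteq> r \<and> p \<noteq> s \<and> \<not> p \<frown> s"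

text \<open>The path is \<open>w2 u1 w3 u2\<close>; the remaining \<open>w1\<close> and
  \<open>u3\<close> merely witness that \<open>u1\<close> and \<open>w3\<close> are not
  universal.\<close>

lemma forcing_seq_3_iff:
  "(\<exists>ps. forcing_seq G ps \<and> length ps = 3) \<longleftrightarrow>
   (\<exists>a b c d. open_path a b c d \<and>
      (\<exists>x \<in> pverts G. x \<noteq> b \<and> \<not> x \<frown> b) \<and> (\<exists>y \<in> pverts G. y \<noteq> c \<and> \<not> y \<frown> c))"
  (is "?L \<longleftrightarrow> ?R")
proof
  assume ?L
  then obtain u1 w1 u2 w2 u3 w3 where "forcing_seq G [(u1, w1), (u2, w2), (u3, w3)]"
    by (auto simp: length_Suc_conv eval_nat_numeral)
  then have "w2 \<frown> u1" "u1 \<frown> w3" "w3 \<frown> u2" "w2 \<noteq> w3" "w2 \<noteq> u2" "\<not> w2 \<frown> u2"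
      "w1 \<in> pverts G" "w1 \<noteq> u1" "\<not> w1 \<frown> u1" "u3 \<in> pverts G" "u3 \<noteq> w3" "\<not> u3 \<frown> w3"
    by (auto dest: adj_sym)
  then show ?R unfolding open_path_def by blast
next
  assume ?R
  then obtain a b c d x y where "a \<frown> b" "b \<frown> c" "c \<frown> d" "a \<noteq> c" "a \<noteq> d" "\<not> a \<frown> d"
    "x \<in> pverts G" "x \<noteq> b" "\<not> x \<frown> b" "y \<in> pverts G" "y \<noteq> c" "\<not> y \<frown> c"
    unfolding open_path_def by blast
  moreover from this have "b \<frown> a" "d \<frown> c" "\<not> d \<frown> a" "\<not> b \<frown> x" using adj_sym by blast+
  ultimately have "forcing_seq G [(b, x), (d, a), (y, c)]"
    using in_arcsD1 in_arcsD2 by auto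
  then show ?L by (intro exI[of _ "[(b, x), (d, a), (y, c)]"]) simp
qed

section \<open>Open paths in the absence of universal vertices\<close>

lemma path_if_four_cycle:
  assumes "card (pverts G) \<ge> 5" "a \<frown> b" "b \<frown> c" "c \<frown> d" "d \<frown> a" "a \<noteq> c" "b \<noteq> d"
  shows "\<exists>p q r s. open_path p q r s"
proof -
  have pendant: "\<exists>p q r s. open_path p q r s"
    if "a \<frown> b" "b \<frown> c" "c \<frown> d" "d \<frown> a" "a \<noteq> c" "b \<noteq> d" "a \<frown> x" "x \<notin> {a, b, c, d}" for a b c d x
  proof -
    \<comment> \<open>Otherwise \<open>a\<close> and \<open>c\<close> would have the three common
      neighbors \<open>b\<close>, \<open>d\<close>, \<open>x\<close>.\<close>
    have "\<not> x \<frown> c" using common_neighbours_le_2[of a c b d x] that adj_sym by blast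
    then have "open_path x a b c" using that adj_sym unfolding open_path_def by blast
    then show ?thesis by blast
  qed
  have "{a, b, c, d} \<subset> pverts G"
  proof -
    have "card {a, b, c, d} \<le> 4" using card_length[of "[a, b, c, d]"] by simp
    moreover have "{a, b, c, d} \<subseteq> pverts G" using assms by (auto simp: wellformed')
    ultimately show ?thesis using assms(1) by auto
  qed
  then obtain v x where v: "v \<in> {a, b, c, d}" 
      and x: "x \<in> pverts G" "x \<notin> {a, b, c, d}" "v \<frown> x"
    by (rule edge_leaving) simp
  from v consider "v = a" | "v = b" | "v = c" | "v = d" by blast
  then show ?thesis
  proof cases
    case 1
    then show ?thesis using pendant[of a b c d x] assms x by simp
  next
    case 2
    then show ?thesis using pendant[of b c d a x] assms x by simp
  next
    case 3
    then show ?thesis using pendant[of c d a b x] assms x by simp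
  next
    case 4
    then show ?thesis using pendant[of d a b c x] assms x by simp
  qed
qed

text \<open>An edge \<open>z y\<close> leaves the closed neighborhood of \<open>a\<close>. The path
  is \<open>y z a t\<close> with \<open>t\<close> a neighbor of \<open>a\<close> other than
  \<open>z\<close>, chosen so that an edge \<open>y t\<close> would close a 4-cycle sharing an edge
  with the triangle.\<close>

lemma path_if_triangle:
  assumes "a \<frown> b" "b \<frown> c" "c \<frown> a" "u \<in> pverts G" "u \<noteq> a" "\<not> a \<frown> u"
    and "a \<frown> x" "x \<noteq> b" "x \<noteq> c"
  shows "\<exists>p q r s. open_path p q r s"
proof -
  let ?S = "insert a {z. a \<frown> z}"
  have "?S \<subset> pverts G" using assms by (auto simp: wellformed')
  then obtain z y where zy: "z \<in> ?S" "y \<in> pverts G" "y \<notin> ?S" "z \<frown> y"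
    by (rule edge_leaving) simp
  then have z: "y \<noteq> a" "\<not> a \<frown> y" "z \<frown> y" and az: "a \<frown> z" by auto
  consider "z = b" | "z = c" | "z \<noteq> b" "z \<noteq> c" by blast
  then show ?thesis
  proof cases
    case 1
    have "\<not> y \<frown> x" using four_cycle_no_triangle[of a b y x c] 1 z assms adj_sym by blast
    then have "open_path y b a x" using 1 z assms adj_sym unfolding open_path_def by blast
    then show ?thesis by blast
  next
    case 2
    have "\<not> y \<frown> x" using four_cycle_no_triangle[of a c y x b] 2 z assms adj_sym by blast
    then have "open_path y c a x" using 2 z assms adj_sym unfolding open_path_def by blast
    then show ?thesis by blast
  next
    case 3
    have "\<not> y \<frown> b" using four_cycle_no_triangle[of a b y z c] 3 z az assms adj_sym by blast
    then have "open_path y z a b" using 3 z az assms adj_sym unfolding open_path_def by blast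
    then show ?thesis by blast
  qed
qed

text \<open>Four consecutive vertices on a cycle form an open path or close to a 4-cycle; a triangle
  has a vertex with a neighbor outside it, and that vertex is not universal.\<close>

lemma path_if_no_universal:
  assumes "C \<in> cycles G" "card (pverts G) \<ge> 5"
    and nonuniv: "\<And>v. v \<in> pverts G \<Longrightarrow> \<exists>x \<in> pverts G. x \<noteq> v \<and> \<not> x \<frown> v"
  shows "\<exists>p q r s. open_path p q r s"
  using assms(1)
proof (cases rule: cycle_shape)
  case (path a b c d)
  show ?thesis
  proof (cases "a \<frown> d")
    case True
    then show ?thesis using path_if_four_cycle[of a b c d] path assms(2) adj_sym by auto
  next
    case False
    then have "open_path a b c d" using path unfolding open_path_def by auto
    then show ?thesis by blast
  qed
next
  case (triangle a b c)
  have "{a, b, c} \<subset> pverts G"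
  proof
    show "{a, b, c} \<subseteq> pverts G" using triangle(3-) in_arcsD1 by auto
    show "{a, b, c} \<noteq> pverts G" using card_length[of "[a, b, c]"] assms(2) by auto
  qed
  then obtain v x where v: "v \<in> {a, b, c}" "x \<in> pverts G" "x \<notin> {a, b, c}" "v \<frown> x"
    by (rule edge_leaving) simp
  obtain u where u: "u \<in> pverts G" "u \<noteq> v" "\<not> v \<frown> u"
    using nonuniv[of v] v(4) adj_sym in_arcsD1 by blast
  from v(1) consider "v = a" | "v = b" | "v = c" by blast
  then show ?thesis
  proof cases
    case 1
    then show ?thesis using path_if_triangle[of a b c u x] u v triangle by simp
  next
    case 2
    then show ?thesis using path_if_triangle[of b c a u x] u v triangle by simp
  next
    case 3
    then show ?thesis using path_if_triangle[of c a b u x] u v triangle by simp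
  qed
qed

section \<open>Universal vertices and stars with a matching\<close>

lemma star_if_universal:
  assumes "C \<in> cycles G" "D \<in> cycles G" "C \<noteq> D"
    and c: "c \<in> pverts G" "\<And>x. x \<in> pverts G \<Longrightarrow> x \<noteq> c \<Longrightarrow> x \<frown> c"
  shows "star_plus_disjoint_edges G"
proof -
  define L where "L = pverts G - {c}"
  define M where "M = {{x, y} | x y. x \<in> L \<and> y \<in> L \<and> x \<frown> y}"
  have edges: "{x, y} \<in> M \<longleftrightarrow> x \<in> L \<and> y \<in> L \<and> x \<frown> y" for x y
    unfolding M_def using adj_sym by (auto simp: doubleton_eq_iff)
  have "pairwise disjnt M"
  proof (rule pairwiseI, rule ccontr)
    fix e f assume ef: "e \<in> M" "f \<in> M" "e \<noteq> f" "\<not> disjnt e f"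
    have ends: "\<exists>y. g = {x, y} \<and> x \<in> L \<and> y \<in> L \<and> x \<frown> y" if "g \<in> M" "x \<in> g" for g x
      using that adj_sym unfolding M_def by blast
    from ef(4) obtain x where x: "x \<in> e" "x \<in> f" unfolding disjnt_def by blast
    obtain y where y: "e = {x, y}" "x \<in> L" "y \<in> L" "x \<frown> y" using ends[OF ef(1) x(1)] by blast
    obtain z where z: "f = {x, z}" "z \<in> L" "x \<frown> z" using ends[OF ef(2) x(2)] by blast
    from y z have "c \<frown> x" "c \<frown> y" "c \<frown> z" "y \<frown> x" "z \<frown> x"
      using c(2) adj_sym unfolding L_def by auto
    \<comment> \<open>Two leaf edges at \<open>x\<close> would span with \<open>c\<close> two
      triangles on the edge \<open>c x\<close>.\<close>
    then have "y = z" using triangles_sharing_edge by blast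
    then show False using ef(3) y(1) z(1) by simp
  qed
  moreover have "card M \<ge> 2"
  proof -
    obtain x y where xy: "x \<frown> y" "x \<noteq> c" "y \<noteq> c" "{x, y} \<subseteq> pverts C"
      using cycle_edge_avoiding[OF assms(1)] .
    obtain x' y' where xy': "x' \<frown> y'" "x' \<noteq> c" "y' \<noteq> c" "{x', y'} \<subseteq> pverts D"
      using cycle_edge_avoiding[OF assms(2)] .
    have "{x, y} \<noteq> {x', y'}"
    proof
      assume "{x, y} = {x', y'}"
      then have "{x, y} \<subseteq> pverts D" using xy'(4) by (rule ssubst)
      moreover have "x \<noteq> y" using xy(1) adj_irrefl by auto
      ultimately show False using cycle_verts_eq[OF assms(1,2)] assms(3) xy(4) by blast
    qed
    moreover have "{{x, y}, {x', y'}} \<subseteq> M"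
      using xy xy' edges wellformed' unfolding L_def by auto
    moreover have "finite M"
      by (rule finite_subset[of _ "Pow (pverts G)"]) (auto simp: M_def L_def pair_finite_verts)
    ultimately show ?thesis using card_mono[of M "{{x, y}, {x', y'}}"] by simp
  qed
  moreover have "\<forall>e \<in> M. e \<subseteq> L \<and> card e = 2"
  proof
    fix e assume "e \<in> M"
    then obtain x y where "e = {x, y}" "x \<in> L" "y \<in> L" "x \<frown> y" unfolding M_def by blast
    moreover from this have "x \<noteq> y" using adj_irrefl by auto
    ultimately show "e \<subseteq> L \<and> card e = 2" by simp
  qed
  moreover have "G = add_edges (star_graph c L) M"
  proof -
    have "parcs G = {c} \<times> L \<union> L \<times> {c} \<union> {(u, v). {u, v} \<in> M}"
      using c adj_sym adj_irrefl by (auto simp: edges L_def wellformed')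
    moreover have "pverts G = insert c L" using c unfolding L_def by auto
    ultimately show ?thesis by (simp add: add_edges_def star_graph_def)
  qed
  moreover have "c \<notin> L" unfolding L_def by simp
  ultimately show ?thesis unfolding star_plus_disjoint_edges_def by blast
qed

text \<open>Eliminates \<open>L\<close> and \<open>M\<close>: away from the universal vertex
  \<open>c\<close>, no vertex has two different neighbors.\<close>

lemma star_plus_disjoint_edgesE:
  assumes "star_plus_disjoint_edges G"
  obtains c where "c \<in> pverts G" "\<And>x. x \<in> pverts G \<Longrightarrow> x \<noteq> c \<Longrightarrow> x \<frown> c"
    "\<And>x y z. x \<frown> y \<Longrightarrow> y \<frown> z \<Longrightarrow> c \<notin> {x, y, z} \<Longrightarrow> x = z"
proof -
  obtain c L M where h: "c \<notin> L" "\<forall>e \<in> M. e \<subseteq> L \<and> card e = 2" "pairwise disjnt M"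
    and G: "G = add_edges (star_graph c L) M"
    using assms unfolding star_plus_disjoint_edges_def by blast
  have E: "x \<frown> y \<longleftrightarrow> x = c \<and> y \<in> L \<or> x \<in> L \<and> y = c \<or> {x, y} \<in> M" for x y
    unfolding G add_edges_def star_graph_def by auto
  have V: "pverts G = insert c L" unfolding G add_edges_def star_graph_def by simp
  show thesis
  proof (rule that[of c])
    fix x y z assume "x \<frown> y" "y \<frown> z" "c \<notin> {x, y, z}"
    then have "{x, y} \<in> M" "{y, z} \<in> M" using E by auto
    moreover have "\<not> disjnt {x, y} {y, z}" by simp
    ultimately have "{x, y} = {y, z}" using pairwiseD[OF h(3)] by metis
    then show "x = z" by (auto simp: doubleton_eq_iff)
  qed (use E V in auto)
qed

lemma forcing_seq_3_iff_not_star: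
  assumes "C \<in> cycles G" "D \<in> cycles G" "C \<noteq> D"
  shows "(\<exists>ps. forcing_seq G ps \<and> length ps = 3) \<longleftrightarrow> \<not> star_plus_disjoint_edges G"
proof
  assume "\<exists>ps. forcing_seq G ps \<and> length ps = 3"
  then obtain p q r s x y where h: "p \<frown> q" "q \<frown> r" "r \<frown> s" "p \<noteq> r" "p \<noteq> s" "\<not> p \<frown> s"
    "x \<in> pverts G" "x \<noteq> q" "\<not> x \<frown> q" "y \<in> pverts G" "y \<noteq> r" "\<not> y \<frown> r"
    unfolding forcing_seq_3_iff open_path_def by blast
  show "\<not> star_plus_disjoint_edges G"
  proof
    assume "star_plus_disjoint_edges G"
    then obtain c where c: "c \<in> pverts G" "\<And>x. x \<in> pverts G \<Longrightarrow> x \<noteq> c \<Longrightarrow> x \<frown> c"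
      "\<And>x y z. x \<frown> y \<Longrightarrow> y \<frown> z \<Longrightarrow> c \<notin> {x, y, z} \<Longrightarrow> x = z"
      by (rule star_plus_disjoint_edgesE) blast
    \<comment> \<open>The inner vertices are not universal, so \<open>p q r\<close> can meet
      \<open>c\<close> only in \<open>p\<close>; then \<open>q r s\<close> avoids \<open>c\<close>
      although its ends differ.\<close>
    have "q \<noteq> c" "r \<noteq> c" using c(2) h by auto
    moreover from this have "p = c" using c(3)[of p q r] h by auto
    moreover have "q \<noteq> s" using h by auto
    ultimately show False using c(3)[of q r s] h by auto
  qed
next
  assume nostar: "\<not> star_plus_disjoint_edges G"
  then have nonuniv: "\<exists>x \<in> pverts G. x \<noteq> v \<and> \<not> x \<frown> v" if "v \<in> pverts G" for v
    using star_if_universal[OF assms that] by blast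
  from path_if_no_universal[OF assms(1) card_pverts_ge_5[OF assms] nonuniv]
  obtain p q r s where path: "open_path p q r s" by blast
  then have "q \<in> pverts G" "r \<in> pverts G" unfolding open_path_def using in_arcsD1 by auto
  then show "\<exists>ps. forcing_seq G ps \<and> length ps = 3"
    unfolding forcing_seq_3_iff using path nonuniv by blast
qed

lemma forcing_seq_2_exists:
  assumes "C \<in> cycles G" "D \<in> cycles G" "C \<noteq> D"
  shows "\<exists>ps. forcing_seq G ps \<and> length ps = 2"
proof (cases "star_plus_disjoint_edges G")
  case False
  then show ?thesis
    using forcing_seq_3_iff_not_star[OF assms] forcing_seq_shorten[of G _ 2] by auto
next
  case True
  then obtain c where c: "c \<in> pverts G" "\<And>x. x \<in> pverts G \<Longrightarrow> x \<noteq> c \<Longrightarrow> x \<frown> c"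
    "\<And>x y z. x \<frown> y \<Longrightarrow> y \<frown> z \<Longrightarrow> c \<notin> {x, y, z} \<Longrightarrow> x = z"
    by (rule star_plus_disjoint_edgesE) blast
  obtain x y where xy: "x \<frown> y" "x \<noteq> c" "y \<noteq> c"
    using cycle_edge_avoiding[OF assms(1)] by metis
  have "card {c, x, y} \<le> 3" using card_length[of "[c, x, y]"] by simp
  then have "\<not> pverts G \<subseteq> {c, x, y}"
    using card_pverts_ge_5[OF assms] card_mono[of "{c, x, y}" "pverts G"] by auto
  then obtain z where z: "z \<in> pverts G" "z \<noteq> c" "z \<noteq> x" "z \<noteq> y" by blast
  have "\<not> x \<frown> z" "\<not> z \<frown> y"
    using c(3)[of y x z] c(3)[of x y z] xy z adj_sym by blast+
  \<comment> \<open>\<open>x y\<close> is an edge between leaves, and a further leaf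
    \<open>z\<close> is adjacent to neither end by the matching property.\<close>
  then have "forcing_seq G [(x, z), (z, y)]"
    using xy z by (auto simp: wellformed')
  then show ?thesis by (intro exI[of _ "[(x, z), (z, y)]"]) simp
qed

end

theorem theorem4p10:
  fixes G :: "'a pair_pre_digraph" and n :: nat
  assumes "cactus G"
    and "n = card (pverts G)"
    and "n \<ge> 4"
    and "\<exists>C \<in> cycles G. \<exists>D \<in> cycles G. C \<noteq> D"
  shows "n - 4 \<le> zero_forcing_number (complement_graph G)
      \<and> zero_forcing_number (complement_graph G) \<le> n - 2
      \<and> (zero_forcing_number (complement_graph G) = n - 2 \<longleftrightarrow> star_plus_disjoint_edges G)
      \<and> (zero_forcing_number (complement_graph G) = n - 4 \<longleftrightarrow> has_special_4_cycle G)
      \<and> (\<not> star_plus_disjoint_edges G \<and> \<not> has_special_4_cycle G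
           \<longrightarrow> zero_forcing_number (complement_graph G) = n - 3)"
proof -
  interpret pair_graph G using assms(1) unfolding cactus_def by blast
  interpret cactus_graph G using assms(1) by unfold_locales
  let ?z = "zero_forcing_number (complement_graph G)"
  obtain C D where CD: "C \<in> cycles G" "D \<in> cycles G" "C \<noteq> D" using assms(4) by blast
  obtain ps where ps: "forcing_seq G ps" "?z + length ps = n"
    using zero_forcing_number_attained assms(2) by blast
  \<comment> \<open>\<open>length ps\<close> is the maximal length. The guard
    \<open>k \<le> n\<close> keeps the truncated difference \<open>n - k\<close> exact.\<close>
  have max: "(\<exists>qs. forcing_seq G qs \<and> length qs = k) \<longleftrightarrow> k \<le> length ps" if "k \<le> n" for k
    using forcing_seq_shorten[OF ps(1)] zero_forcing_number_le ps(2) assms(2) that by fastforce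
  have n: "n \<ge> 5" using card_pverts_ge_5[OF CD] assms(2) by simp
  have "2 \<le> length ps" using forcing_seq_2_exists[OF CD] max[of 2] n by simp
  moreover have "length ps \<le> 4" using forcing_seq_length_le_4[OF ps(1)] .
  moreover have "3 \<le> length ps \<longleftrightarrow> \<not> star_plus_disjoint_edges G"
    using forcing_seq_3_iff_not_star[OF CD] max[of 3] n by simp
  moreover have "4 \<le> length ps \<longleftrightarrow> has_special_4_cycle G"
    using forcing_seq_4_iff max[of 4] n by simp
  moreover have "?z = n - length ps" using ps(2) by simp
  ultimately show ?thesis using n by auto
qed

end
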